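(* The 4-Colored Cross Problem has time complexity $\Omega(n\log n)$ in the algebraic computation tree model; that is, any algebraic computation tree solving the 4-Colored Cross Problem on inputs of $n$ points has complexity $\Omega(n\log n)$.
   Context: The 4-Colored Cross Problem: given a set $P$ of $n$ points in $\mathbb{R}^2$, each assigned one of $k$ colors, decide whether there exists a point $c\in\mathbb{R}^2$ (not necessarily in $P$) such that each of the four open quadrants of $c$ contains a point of $P$, these four points having pairwise different colors. The open quadrants of $c=(c_x,c_y)$ are $\{x>c_x,y>c_y\}$, $\{x<c_x,y>c_y\}$, $\{x<c_x,y<c_y\}$, $\{x>c_x,y<c_y\}$. The number $k$ of colors is arbitrary, and the input consists of the coordinates and colors (encoded as numbers) of the points. No general position is assumed: coordinates may repeat, and points are regarded as colored objects whose locations may coincide. The algebraic computation tree model is Ben-Or's: a tree for each input size whose nodes perform arithmetic operations ($+,-,\times,/$, square roots) on input values, constants and earlier results, or branch on the sign ($>0$, $\ge 0$, $=0$) of a computed value, with YES/NO leaves; the complexity is the maximum length of a root-to-leaf path. *)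

theory Defs
  imports Complex_Main
begin

text \<open>\<open>Result j\<close> refers to the value computed at the \<open>j\<close>-th computation node
  (counting from \<open>0\<close>) on the path from the root.\<close>

datatype operand = Input nat | Const real | Result nat

datatype operation =
    Add operand operand
  | Sub operand operand
  | Mul operand operand
  | Div operand operand
  | Sqrt operand

datatype sign_test = Positive | Nonnegative | Zero

datatype ctree =
    Leaf bool
  | Compute operation ctree
  | Branch sign_test operand ctree ctree

text \<open>In the well-formedness predicates, \<open>m\<close> is the number of input values and \<open>r\<close> the number
  of results already computed by the ancestors of the node.\<close>

primrec wf_operand :: "nat \<Rightarrow> nat \<Rightarrow> operand \<Rightarrow> bool" where
  "wf_operand m r (Input i) \<longleftrightarrow> i < m"
| "wf_operand m r (Const c) \<longleftrightarrow> True"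
| "wf_operand m r (Result j) \<longleftrightarrow> j < r"

primrec wf_operation :: "nat \<Rightarrow> nat \<Rightarrow> operation \<Rightarrow> bool" where
  "wf_operation m r (Add a b) \<longleftrightarrow> wf_operand m r a \<and> wf_operand m r b"
| "wf_operation m r (Sub a b) \<longleftrightarrow> wf_operand m r a \<and> wf_operand m r b"
| "wf_operation m r (Mul a b) \<longleftrightarrow> wf_operand m r a \<and> wf_operand m r b"
| "wf_operation m r (Div a b) \<longleftrightarrow> wf_operand m r a \<and> wf_operand m r b"
| "wf_operation m r (Sqrt a) \<longleftrightarrow> wf_operand m r a"

primrec wf_ctree :: "nat \<Rightarrow> nat \<Rightarrow> ctree \<Rightarrow> bool" where
  "wf_ctree m r (Leaf b) \<longleftrightarrow> True"
| "wf_ctree m r (Compute f t) \<longleftrightarrow> wf_operation m r f \<and> wf_ctree m (Suc r) t"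
| "wf_ctree m r (Branch s a t u) \<longleftrightarrow> wf_operand m r a \<and> wf_ctree m r t \<and> wf_ctree m r u"

text \<open>In the evaluation functions, \<open>xs\<close> is the input and \<open>vs\<close> the list of earlier results.
  Division by zero and square roots of negative numbers abort the computation with \<open>None\<close>.\<close>

primrec operand_val :: "real list \<Rightarrow> real list \<Rightarrow> operand \<Rightarrow> real" where
  "operand_val xs vs (Input i) = xs ! i"
| "operand_val xs vs (Const c) = c"
| "operand_val xs vs (Result j) = vs ! j"

primrec operation_val :: "real list \<Rightarrow> real list \<Rightarrow> operation \<Rightarrow> real option" where
  "operation_val xs vs (Add a b) = Some (operand_val xs vs a + operand_val xs vs b)"
| "operation_val xs vs (Sub a b) = Some (operand_val xs vs a - operand_val xs vs b)"
| "operation_val xs vs (Mul a b) = Some (operand_val xs vs a * operand_val xs vs b)"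
| "operation_val xs vs (Div a b) =
     (if operand_val xs vs b = 0 then None else Some (operand_val xs vs a / operand_val xs vs b))"
| "operation_val xs vs (Sqrt a) =
     (if operand_val xs vs a < 0 then None else Some (sqrt (operand_val xs vs a)))"

primrec passes :: "sign_test \<Rightarrow> real \<Rightarrow> bool" where
  "passes Positive v \<longleftrightarrow> v > 0"
| "passes Nonnegative v \<longleftrightarrow> v \<ge> 0"
| "passes Zero v \<longleftrightarrow> v = 0"

primrec run :: "ctree \<Rightarrow> real list \<Rightarrow> real list \<Rightarrow> bool option" where
  "run (Leaf b) xs vs = Some b"
| "run (Compute f t) xs vs =
     (case operation_val xs vs f of None \<Rightarrow> None | Some v \<Rightarrow> run t xs (vs @ [v]))"
| "run (Branch s a t u) xs vs =
     (if passes s (operand_val xs vs a) then run t xs vs else run u xs vs)"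

primrec complexity :: "ctree \<Rightarrow> nat" where
  "complexity (Leaf b) = 0"
| "complexity (Compute f t) = Suc (complexity t)"
| "complexity (Branch s a t u) = Suc (max (complexity t) (complexity u))"

definition quadrant_NE :: "real \<times> real \<Rightarrow> (real \<times> real) set" where
  "quadrant_NE c = {(x, y). x > fst c \<and> y > snd c}"

definition quadrant_NW :: "real \<times> real \<Rightarrow> (real \<times> real) set" where
  "quadrant_NW c = {(x, y). x < fst c \<and> y > snd c}"

definition quadrant_SW :: "real \<times> real \<Rightarrow> (real \<times> real) set" where
  "quadrant_SW c = {(x, y). x < fst c \<and> y < snd c}"

definition quadrant_SE :: "real \<times> real \<Rightarrow> (real \<times> real) set" where
  "quadrant_SE c = {(x, y). x > fst c \<and> y < snd c}"

text \<open>A colored point is a pair of a location and a color; since an instance is a list,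
  locations may coincide. Colors are numbers between \<open>1\<close> and \<open>k\<close>.\<close>

type_synonym colored_point = "(real \<times> real) \<times> nat"

definition colored_instance :: "nat \<Rightarrow> nat \<Rightarrow> colored_point list \<Rightarrow> bool" where
  "colored_instance n k ps \<longleftrightarrow> length ps = n \<and> (\<forall>p \<in> set ps. snd p \<in> {1..k})"

definition has_four_colored_cross :: "colored_point list \<Rightarrow> bool" where
  "has_four_colored_cross ps \<longleftrightarrow>
     (\<exists>c. \<exists>p1 \<in> set ps. \<exists>p2 \<in> set ps. \<exists>p3 \<in> set ps. \<exists>p4 \<in> set ps.
        fst p1 \<in> quadrant_NE c \<and> fst p2 \<in> quadrant_NW c \<and>
        fst p3 \<in> quadrant_SW c \<and> fst p4 \<in> quadrant_SE c \<and>
        distinct [snd p1, snd p2, snd p3, snd p4])"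

definition encode :: "colored_point list \<Rightarrow> real list" where
  "encode ps = concat (map (\<lambda>((x, y), col). [x, y, real col]) ps)"

text \<open>The number of colors \<open>k\<close> is neither bounded nor known to the tree.\<close>

definition solves_four_colored_cross :: "nat \<Rightarrow> ctree \<Rightarrow> bool" where
  "solves_four_colored_cross n T \<longleftrightarrow>
     wf_ctree (3 * n) 0 T \<and>
     (\<forall>k ps. colored_instance n k ps \<longrightarrow>
        run T (encode ps) [] = Some (has_four_colored_cross ps))"

end

theory Submission
  imports Defs "HOL-Analysis.Function_Topology" "HOL-Library.Function_Algebras"
begin

text \<open>Four colors and a suitable choice of about \<open>n/2\<close> fixed points leave about \<open>n/2\<close> points that move
  on the diagonal, such that the instances with all moving points at integer positions, at least
  \<open>(n/4) ^ (n/4)\<close> in number, are isolated NO instances.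

  Fixing the sign at every node of a computation path splits these instances into at most \<open>3 ^ h\<close>
  classes, where \<open>h\<close> is the height of the tree. With one new variable per computation node, a class
  consists of isolated zeros, within an open set, of a sum of squares \<open>F\<close> of degree \<open>4\<close> in
  \<open>d \<le> v + h\<close> variables, \<open>v\<close> being the number of moving points.

  In place of the Milnor--Thom bound, isolated zeros of a nonnegative polynomial \<open>F\<close> of degree \<open>m\<close>
  are counted directly. Near each of them \<open>F + \<epsilon> * (\<Sum>i<d. y i ^ (m + 1))\<close> has a local minimum for small
  \<open>\<epsilon> > 0\<close>. The critical points satisfy equations \<open>y i ^ m = g i y\<close> with \<open>g i\<close> of degree less than \<open>m\<close>, so
  all polynomial functions on the set of critical points are combinations of \<open>m ^ d\<close> monomials, and
  by interpolation there are at most \<open>m ^ d\<close> critical points. Hence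
  \<open>(n/4) ^ (n/4) \<le> 3 ^ h * 4 ^ (v + h)\<close>.\<close>

subsection \<open>Polynomial functions\<close>

text \<open>Points are functions on all of \<open>nat\<close>, so that the number of variables can
  grow along a computation path without a change of type. \<open>k\<close> only bounds the total
  degree.\<close>

inductive poly_fun :: "nat \<Rightarrow> nat \<Rightarrow> ((nat \<Rightarrow> real) \<Rightarrow> real) \<Rightarrow> bool" for d k where
  monomial: "(\<Sum>i<d. e i) \<le> k \<Longrightarrow> poly_fun d k (\<lambda>y. c * (\<Prod>i<d. y i ^ e i))"
| add: "poly_fun d k f \<Longrightarrow> poly_fun d k g \<Longrightarrow> poly_fun d k (\<lambda>y. f y + g y)"

lemma poly_fun_const: "poly_fun d k (\<lambda>_. c)"
  using poly_fun.monomial[of "\<lambda>_. 0" d k c] by simp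

lemma poly_fun_var:
  assumes "i < d"
  shows "poly_fun d (Suc k) (\<lambda>y. y i)"
proof -
  have "(\<Prod>j<d. y j ^ (if j = i then 1 else 0)) = y i" for y :: "nat \<Rightarrow> real"
  proof -
    have "(\<Prod>j<d. y j ^ (if j = i then 1 else 0)) = (\<Prod>j<d. if j = i then y j else 1)"
      by (rule prod.cong) auto
    then show ?thesis
      using assms by simp
  qed
  then show ?thesis
    using poly_fun.monomial[of "\<lambda>j. if j = i then 1 else 0" d "Suc k" 1] assms by simp
qed

lemma poly_fun_mono:
  assumes "poly_fun d k f" "d \<le> d'" "k \<le> k'"
  shows "poly_fun d' k' f"
  using assms(1)
proof induction
  case (monomial e c)
  \<comment> \<open>Exponents from \<open>d\<close> on are arbitrary, so they are cleared before the
    product is extended to the variables below \<open>d'\<close>.\<close>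
  let ?e = "\<lambda>i. if i < d then e i else 0"
  have *: "{..<d'} \<inter> {i. i < d} = {..<d}"
    using assms(2) by auto
  have "(\<Sum>i<d'. ?e i) = (\<Sum>i<d. e i)"
    using * by (simp add: sum.If_cases)
  moreover have "(\<Prod>i<d'. y i ^ ?e i) = (\<Prod>i<d. y i ^ e i)" for y :: "nat \<Rightarrow> real"
  proof -
    have "(\<Prod>i<d'. y i ^ ?e i) = (\<Prod>i<d'. if i < d then y i ^ e i else 1)"
      by (rule prod.cong) auto
    then show ?thesis
      using * by (simp add: prod.If_cases)
  qed
  ultimately show ?case
    using poly_fun.monomial[of ?e d' k' c] monomial assms(3) by simp
qed (rule poly_fun.add)

lemma poly_fun_mult:
  assumes "poly_fun d k f" "poly_fun d l g"
  shows "poly_fun d (k + l) (\<lambda>y. f y * g y)"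
  using assms(1)
proof induction
  case (monomial e c)
  show ?case
    using assms(2)
  proof induction
    case (monomial e' c')
    with \<open>sum e {..<d} \<le> k\<close> show ?case
      using poly_fun.monomial[of "\<lambda>i. e i + e' i" d "k + l" "c * c'"]
      by (simp add: sum.distrib power_add prod.distrib mult_ac)
  next
    case (add f g)
    then show ?case
      using poly_fun.add by (simp add: distrib_left)
  qed
next
  case (add f g)
  then show ?case
    using poly_fun.add by (simp add: distrib_right)
qed

lemma poly_fun_scale: "poly_fun d k f \<Longrightarrow> poly_fun d k (\<lambda>y. c * f y)"
  using poly_fun_mult[OF poly_fun_const[of d 0 c], of k f] by simp

lemma poly_fun_diff: "poly_fun d k f \<Longrightarrow> poly_fun d k g \<Longrightarrow> poly_fun d k (\<lambda>y. f y - g y)"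
  using poly_fun.add[OF _ poly_fun_scale[of d k g "-1"]] by simp

lemma poly_fun_square: "poly_fun d k f \<Longrightarrow> poly_fun d (2 * k) (\<lambda>y. (f y)\<^sup>2)"
  using poly_fun_mult[of d k f k f] by (simp add: power2_eq_square mult_2)

lemma poly_fun_prod:
  assumes "finite S" "\<And>s. s \<in> S \<Longrightarrow> poly_fun d k (f s)"
  shows "poly_fun d (card S * k) (\<lambda>y. \<Prod>s\<in>S. f s y)"
  using assms
proof (induction S)
  case (insert s S)
  then have "poly_fun d (k + card S * k) (\<lambda>y. f s y * (\<Prod>s\<in>S. f s y))"
    by (intro poly_fun_mult) auto
  with insert show ?case
    by simp
qed (simp add: poly_fun_const)

lemma poly_fun_cong:
  assumes "poly_fun d k f" "\<And>i. i < d \<Longrightarrow> y i = y' i"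
  shows "f y = f y'"
  using assms by induction auto

lemma continuous_on_poly_fun:
  assumes "poly_fun d k f"
  shows "continuous_on S f"
  using assms
proof induction
  case (monomial e c)
  have "continuous_on S (\<lambda>y :: nat \<Rightarrow> real. y i)" for i
    by (rule continuous_on_subset[OF continuous_on_product_coordinates]) simp
  then show ?case
    by (intro continuous_on_mult continuous_on_const continuous_on_prod continuous_on_power)
qed (rule continuous_on_add)

lemma poly_fun_partial_derivative:
  assumes "poly_fun d (Suc k) f" "i < d"
  shows "\<exists>g. poly_fun d k g \<and>
    (\<forall>y. ((\<lambda>s. f (y(i := s))) has_real_derivative g y) (at (y i)))"
  using assms(1)
proof induction
  case (monomial e c)
  let ?e = "e(i := e i - 1)"
  have ins: "{..<d} = insert i ({..<d} - {i})"
    using assms(2) by auto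
  have split: "(\<Prod>j<d. z j ^ a j) = z i ^ a i * (\<Prod>j\<in>{..<d} - {i}. z j ^ a j)"
    for a and z :: "nat \<Rightarrow> real"
    by (subst ins) (subst prod.insert, auto)
  \<comment> \<open>For \<open>e i = 0\<close> the exponents do not drop, so the degree may still be
    \<open>Suc k\<close>, but then the coefficient is zero.\<close>
  have "poly_fun d k (\<lambda>y. (c * real (e i)) * (\<Prod>j<d. y j ^ ?e j))"
  proof (cases "e i = 0")
    case True
    then show ?thesis
      by (simp add: poly_fun_const)
  next
    case False
    have "(\<Sum>j<d. e j) = e i + (\<Sum>j\<in>{..<d} - {i}. e j)"
      by (subst ins) (subst sum.insert, auto)
    moreover have "(\<Sum>j<d. ?e j) = e i - 1 + (\<Sum>j\<in>{..<d} - {i}. e j)"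
      by (subst ins) (subst sum.insert, auto)
    ultimately show ?thesis
      using monomial False by (intro poly_fun.monomial) linarith
  qed
  moreover have "((\<lambda>s. c * (\<Prod>j<d. (y(i := s)) j ^ e j)) has_real_derivative
      (c * real (e i)) * (\<Prod>j<d. y j ^ ?e j)) (at (y i))" for y
    unfolding split by (auto intro!: derivative_eq_intros)
  ultimately show ?case
    by (intro exI conjI allI)
next
  case (add f g)
  then obtain f' g' where *: "poly_fun d k f'" "poly_fun d k g'"
    "\<And>y. ((\<lambda>s. f (y(i := s))) has_real_derivative f' y) (at (y i))"
    "\<And>y. ((\<lambda>s. g (y(i := s))) has_real_derivative g' y) (at (y i))"
    by blast
  then show ?case
    by (intro exI[of _ "\<lambda>y. f' y + g' y"]) (auto intro!: poly_fun.add DERIV_add simp del: fun_upd_apply)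
qed

section \<open>Counting the solutions of \<open>y i ^ m = g i y\<close> by dimension\<close>

lemma sum_fun_apply: "(\<Sum>a\<in>A. f a) x = (\<Sum>a\<in>A. f a x)"
  for f :: "'a \<Rightarrow> 'b \<Rightarrow> 'c::comm_monoid_add"
  by (induction A rule: infinite_finite_induct) auto

text \<open>The indicators of the points of \<open>Z\<close> are linearly independent, and they lie
  in the span of the functions \<open>b e\<close> cut off outside \<open>Z\<close>, whose dimension
  is at most \<open>card E\<close>.\<close>

lemma card_le_card_spanning_functions:
  fixes b :: "'e \<Rightarrow> 'a \<Rightarrow> real"
  assumes "finite Z" "finite E"
    and span: "\<And>z. z \<in> Z \<Longrightarrow> \<exists>a. \<forall>w\<in>Z. of_bool (w = z) = (\<Sum>e\<in>E. a e * b e w)"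
  shows "card Z \<le> card E"
proof -
  define scale where "scale = (\<lambda>(c::real) (f :: 'a \<Rightarrow> real) x. c * f x)"
  interpret vector_space scale
    by unfold_locales (auto simp: scale_def fun_eq_iff algebra_simps)
  define ind where "ind = (\<lambda>z w :: 'a. of_bool (w = z) :: real)"
  \<comment> \<open>The hypothesis speaks only about points of \<open>Z\<close>. Off
    \<open>Z\<close> all indicators vanish, so the spanning functions are set to zero there.\<close>
  define res where "res = (\<lambda>e w. if w \<in> Z then b e w else 0)"
  have inj: "inj_on ind Z"
    by (auto simp: inj_on_def ind_def fun_eq_iff split: if_splits)
  have "independent (ind ` Z)"
  proof
    assume "dependent (ind ` Z)"
    then obtain u where u: "\<exists>v\<in>ind ` Z. u v \<noteq> 0" "(\<Sum>v\<in>ind ` Z. scale (u v) v) = 0"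
      using assms(1) by (auto simp: dependent_finite)
    then have *: "(\<Sum>z\<in>Z. scale (u (ind z)) (ind z)) = 0"
      using inj by (simp add: sum.reindex)
    have "u (ind w) = 0" if "w \<in> Z" for w
    proof -
      have "(\<Sum>z\<in>Z. scale (u (ind z)) (ind z)) w = (\<Sum>z\<in>Z. if w = z then u (ind z) else 0)"
        unfolding sum_fun_apply by (rule sum.cong) (auto simp: scale_def ind_def)
      then show ?thesis
        using * that assms(1) by simp
    qed
    with u(1) show False
      by auto
  qed
  moreover have "ind ` Z \<subseteq> span (res ` E)"
  proof
    fix f assume "f \<in> ind ` Z"
    then obtain z where z: "z \<in> Z" "f = ind z"
      by auto
    from span[OF z(1)] obtain a
      where a: "\<forall>w\<in>Z. of_bool (w = z) = (\<Sum>e\<in>E. a e * b e w)"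
      by blast
    have "f = (\<Sum>e\<in>E. scale (a e) (res e))"
    proof
      fix w
      show "f w = (\<Sum>e\<in>E. scale (a e) (res e)) w"
        using a z by (cases "w \<in> Z") (auto simp: sum_fun_apply scale_def res_def ind_def)
    qed
    also have "\<dots> \<in> span (res ` E)"
      by (intro span_sum span_scale span_base) auto
    finally show "f \<in> span (res ` E)" .
  qed
  ultimately have "card (ind ` Z) \<le> card (res ` E)"
    using independent_span_bound[of "res ` E" "ind ` Z"] assms(2) by simp
  then show ?thesis
    using card_image[OF inj] card_image_le[OF assms(2), of res] by simp
qed

text \<open>On \<open>Z\<close> the equations rewrite \<open>y i ^ m\<close> to a polynomial of smaller degree, so that the
  \<open>m ^ d\<close> monomials with all exponents below \<open>m\<close> span the polynomial functions.\<close>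

lemma poly_fun_reduce:
  assumes eqs: "\<And>i. i < d \<Longrightarrow> poly_fun d (m - 1) (g i)"
    and "0 < m"
    and Z: "\<And>y i. y \<in> Z \<Longrightarrow> i < d \<Longrightarrow> y i ^ m = g i y"
    and f: "poly_fun d k f"
  shows "\<exists>a. \<forall>y\<in>Z. f y = (\<Sum>e\<in>{..<d} \<rightarrow>\<^sub>E {..<m}. a e * (\<Prod>i<d. y i ^ e i))"
    (is "?R f")
  using f
proof (induction k arbitrary: f rule: less_induct)
  case (less k)
  let ?E = "{..<d} \<rightarrow>\<^sub>E {..<m}"
  have R_add: "?R (\<lambda>y. f y + h y)" if "?R f" "?R h" for f h
  proof -
    from that obtain a b where
      "\<forall>y\<in>Z. f y = (\<Sum>e\<in>?E. a e * (\<Prod>i<d. y i ^ e i))"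
      "\<forall>y\<in>Z. h y = (\<Sum>e\<in>?E. b e * (\<Prod>i<d. y i ^ e i))"
      by blast
    then show ?thesis
      by (intro exI[of _ "\<lambda>e. a e + b e"]) (simp add: distrib_right sum.distrib)
  qed
  have fin: "finite ?E"
    by (auto intro: finite_PiE)
  \<comment> \<open>The outer induction is on the degree bound, this inner one on the structure of
    \<open>f\<close> for a fixed bound.\<close>
  from less.prems show ?case
  proof induction
    case (monomial e c)
    show ?case
    proof (cases "\<forall>i<d. e i < m")
      case True
      let ?e = "restrict e {..<d}"
      have mem: "?e \<in> ?E"
        using True by auto
      have "(\<Sum>e'\<in>?E. (if e' = ?e then c else 0) * (\<Prod>i<d. y i ^ e' i)) =
          c * (\<Prod>i<d. y i ^ e i)" for y :: "nat \<Rightarrow> real"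
      proof -
        have "(\<Sum>e'\<in>?E. (if e' = ?e then c else 0) * (\<Prod>i<d. y i ^ e' i)) =
            (\<Sum>e'\<in>?E. if e' = ?e then c * (\<Prod>i<d. y i ^ e' i) else 0)"
          by (rule sum.cong) auto
        then show ?thesis
          using mem fin by simp
      qed
      then show ?thesis
        by (intro exI[of _ "\<lambda>e'. if e' = ?e then c else 0"]) simp
    next
      case False
      then obtain i where i: "i < d" "m \<le> e i"
        by auto
      let ?e = "e(i := e i - m)"
      have ins: "{..<d} = insert i ({..<d} - {i})"
        using i by auto
      have "(\<Sum>j<d. e j) = e i + (\<Sum>j\<in>{..<d} - {i}. e j)"
        by (subst ins) (subst sum.insert, auto)
      moreover have "(\<Sum>j<d. ?e j) = e i - m + (\<Sum>j\<in>{..<d} - {i}. e j)"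
        by (subst ins) (subst sum.insert, auto)
      ultimately have deg: "(\<Sum>j<d. ?e j) \<le> k - m" "m \<le> k"
        using monomial i by linarith+
      \<comment> \<open>Trading the factor \<open>y i ^ m\<close> for \<open>g i y\<close> loses
        degree \<open>m\<close> and gains at most \<open>m - 1\<close>, so the outer induction
        hypothesis applies.\<close>
      have "poly_fun d (k - m + (m - 1)) (\<lambda>y. c * (\<Prod>j<d. y j ^ ?e j) * g i y)"
        by (intro poly_fun_mult poly_fun.monomial deg eqs i)
      then have "poly_fun d (k - 1) (\<lambda>y. c * (\<Prod>j<d. y j ^ ?e j) * g i y)"
        using deg assms(2) by simp
      then obtain a where a: "\<forall>y\<in>Z. c * (\<Prod>j<d. y j ^ ?e j) * g i y =
          (\<Sum>e\<in>?E. a e * (\<Prod>i<d. y i ^ e i))"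
        using less.IH[of "k - 1"] deg assms(2) by fastforce
      have split: "(\<Prod>j<d. y j ^ a j) = y i ^ a i * (\<Prod>j\<in>{..<d} - {i}. y j ^ a j)"
        for a and y :: "nat \<Rightarrow> real"
        by (subst ins) (subst prod.insert, auto)
      have "c * (\<Prod>j<d. y j ^ e j) = c * (\<Prod>j<d. y j ^ ?e j) * g i y" if "y \<in> Z" for y
      proof -
        have "y i ^ e i = y i ^ (e i - m) * g i y"
          using i Z[OF that, of i] by (metis power_add le_add_diff_inverse2)
        then show ?thesis
          unfolding split by simp
      qed
      with a show ?thesis
        by auto
    qed
  next
    case (add f g)
    show ?case
      by (rule R_add) (fact add.IH)+
  qed
qed

text \<open>Interpolation: for each \<open>z\<close> in \<open>Z\<close> a product of linear
  factors, one for each other point \<open>w\<close> in a coordinate \<open>c w\<close> where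
  \<open>w\<close> and \<open>z\<close> differ, is the indicator of \<open>z\<close> on
  \<open>Z\<close>. Its degree is large, but on \<open>Z\<close> it reduces to the
  \<open>m ^ d\<close> monomials.\<close>

lemma card_solutions_le:
  assumes eqs: "\<And>i. i < d \<Longrightarrow> poly_fun d (m - 1) (g i)"
    and "0 < m"
    and Z: "\<And>y i. y \<in> Z \<Longrightarrow> i < d \<Longrightarrow> y i ^ m = g i y"
    and dist: "\<And>y z. y \<in> Z \<Longrightarrow> z \<in> Z \<Longrightarrow> (\<And>i. i < d \<Longrightarrow> y i = z i) \<Longrightarrow> y = z"
    and "finite Z"
  shows "card Z \<le> m ^ d"
proof -
  let ?E = "{..<d} \<rightarrow>\<^sub>E {..<m}"
  have "\<exists>a. \<forall>w\<in>Z. of_bool (w = z) = (\<Sum>e\<in>?E. a e * (\<Prod>i<d. w i ^ e i))" if z: "z \<in> Z" for z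
  proof -
    have "\<exists>i<d. w i \<noteq> z i" if "w \<in> Z - {z}" for w
      using dist that z by blast
    then obtain c where c: "\<And>w. w \<in> Z - {z} \<Longrightarrow> c w < d \<and> w (c w) \<noteq> z (c w)"
      by metis
    define f where "f = (\<lambda>y. \<Prod>w\<in>Z - {z}. (1 / (z (c w) - w (c w))) * (y (c w) - w (c w)))"
    have "poly_fun d (card (Z - {z}) * 1) f"
      unfolding f_def using c assms(5)
      by (intro poly_fun_prod poly_fun_scale poly_fun_diff poly_fun_const)
        (auto simp flip: One_nat_def intro: poly_fun_var[of _ _ 0, simplified])
    then obtain a where a: "\<forall>y\<in>Z. f y = (\<Sum>e\<in>?E. a e * (\<Prod>i<d. y i ^ e i))"
      using poly_fun_reduce[OF eqs assms(2) Z] by blast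
    have "f w = of_bool (w = z)" if "w \<in> Z" for w
    proof (cases "w = z")
      case True
      then have "f w = 1"
        unfolding f_def using c by (intro prod.neutral ballI) (simp, metis)
      with True show ?thesis
        by simp
    next
      case False
      then show ?thesis
        unfolding f_def using that assms(5) by (auto intro!: prod_zero)
    qed
    with a show ?thesis
      by metis
  qed
  moreover have "finite ?E"
    by (auto intro: finite_PiE)
  ultimately have "card Z \<le> card ?E"
    by (intro card_le_card_spanning_functions[OF assms(5), where b = "\<lambda>e w. \<Prod>i<d. w i ^ e i"])
  then show ?thesis
    by (simp add: card_PiE)
qed

subsection \<open>Isolated zeros\<close>

text \<open>On the boundary of the box, \<open>F\<close> has a positive lower bound by compactness,
  whereas \<open>F q = 0\<close>. A small multiple of the bounded \<open>H\<close> cannot make up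
  for this gap, so the minimum over the box is attained in the interior.\<close>

lemma perturbed_local_minimum:
  fixes F H :: "(nat \<Rightarrow> real) \<Rightarrow> real"
  assumes F: "poly_fun d k F" and H: "poly_fun d l H"
    and nonneg: "\<And>y. F y \<ge> 0" and zero: "F q = 0"
    and "\<rho> > 0"
    and iso: "\<And>y i. (\<And>i. i < d \<Longrightarrow> \<bar>y i - q i\<bar> \<le> \<rho>) \<Longrightarrow> F y = 0 \<Longrightarrow> i < d \<Longrightarrow> y i = q i"
  shows "\<exists>\<epsilon>0>0. \<forall>\<epsilon>. 0 < \<epsilon> \<and> \<epsilon> < \<epsilon>0 \<longrightarrow>
    (\<exists>z. (\<forall>i<d. \<bar>z i - q i\<bar> < \<rho>) \<and>
      (\<forall>y. (\<forall>i<d. \<bar>y i - q i\<bar> \<le> \<rho>) \<longrightarrow> F z + \<epsilon> * H z \<le> F y + \<epsilon> * H y))"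
proof -
  \<comment> \<open>Coordinates from \<open>d\<close> on are frozen, so the box is a product of
    compact sets and hence compact.\<close>
  define X where "X = (\<lambda>i. if i < d then {q i - \<rho>..q i + \<rho>} else {q i})"
  define B where "B = PiE UNIV X"
  have "compact B"
    unfolding B_def compactin_euclidean_iff[symmetric] euclidean_product_topology[symmetric]
      compactin_PiE by (auto simp: X_def)
  have in_B: "y \<in> B \<longleftrightarrow> (\<forall>i<d. \<bar>y i - q i\<bar> \<le> \<rho>) \<and> (\<forall>i\<ge>d. y i = q i)" for y
  proof -
    have "y \<in> B \<longleftrightarrow> (\<forall>i. y i \<in> X i)"
      by (auto simp: B_def)
    also have "\<dots> \<longleftrightarrow> (\<forall>i<d. \<bar>y i - q i\<bar> \<le> \<rho>) \<and> (\<forall>i\<ge>d. y i = q i)"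
    proof -
      have "y i \<in> X i \<longleftrightarrow> (i < d \<longrightarrow> \<bar>y i - q i\<bar> \<le> \<rho>) \<and> (d \<le> i \<longrightarrow> y i = q i)" for i
        unfolding X_def by (cases "i < d") (auto simp: abs_le_iff)
      then show ?thesis
        by blast
    qed
    finally show ?thesis .
  qed
  have "q \<in> B"
    using \<open>\<rho> > 0\<close> by (simp add: in_B)
  define S where "S = B \<inter> (\<Union>i<d. {y. \<bar>y i - q i\<bar> = \<rho>})"
  have "closed {y :: nat \<Rightarrow> real. \<bar>y i - q i\<bar> = \<rho>}" for i
    by (intro closed_Collect_eq continuous_on_rabs continuous_on_diff continuous_on_const
        continuous_on_product_coordinates)
  then have "compact S"
    unfolding S_def using \<open>compact B\<close> by (intro compact_Int_closed closed_UN) auto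
  have "\<exists>\<delta>>0. \<forall>y\<in>S. \<delta> \<le> F y"
  proof (cases "S = {}")
    case False
    then obtain s where s: "s \<in> S" "\<forall>y\<in>S. F s \<le> F y"
      using continuous_attains_inf[OF \<open>compact S\<close>] continuous_on_poly_fun[OF F] by blast
    have "F s \<noteq> 0"
    proof
      assume "F s = 0"
      then have "s i = q i" if "i < d" for i
        using s(1) iso[of s i] that by (auto simp: S_def in_B)
      then show False
        using s(1) \<open>\<rho> > 0\<close> by (auto simp: S_def)
    qed
    then show ?thesis
      using s(2) nonneg[of s] by (intro exI[of _ "F s"]) auto
  qed (auto intro: exI[of _ 1])
  then obtain \<delta> where \<delta>: "\<delta> > 0" "\<And>y. y \<in> S \<Longrightarrow> \<delta> \<le> F y"
    by blast
  obtain M where M: "\<And>y. y \<in> B \<Longrightarrow> \<bar>H y\<bar> \<le> M"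
    using continuous_attains_sup[OF \<open>compact B\<close>, of "\<lambda>y. \<bar>H y\<bar>"] \<open>q \<in> B\<close>
      continuous_on_rabs[OF continuous_on_poly_fun[OF H]] by blast
  have "M \<ge> 0"
    using M[OF \<open>q \<in> B\<close>] by simp
  \<comment> \<open>The perturbed function is at least \<open>\<delta> - \<epsilon> * M\<close> on
    \<open>S\<close> and at most \<open>\<epsilon> * M\<close> at \<open>q\<close>, so
    \<open>2 * \<epsilon> * M < \<delta>\<close> suffices; the added \<open>1\<close> keeps the
    denominator positive for \<open>M = 0\<close>.\<close>
  show ?thesis
  proof (intro exI[of _ "\<delta> / (2 * M + 1)"] conjI allI impI)
    show "0 < \<delta> / (2 * M + 1)"
      using \<delta> \<open>M \<ge> 0\<close> by simp
    fix \<epsilon> assume \<epsilon>: "0 < \<epsilon> \<and> \<epsilon> < \<delta> / (2 * M + 1)"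
    then have \<epsilon>': "\<epsilon> * (2 * M + 1) < \<delta>"
      using \<open>M \<ge> 0\<close> by (simp add: field_simps)
    have "continuous_on B (\<lambda>y. F y + \<epsilon> * H y)"
      by (intro continuous_on_add continuous_on_mult continuous_on_const
          continuous_on_poly_fun[OF F] continuous_on_poly_fun[OF H])
    then obtain z where z: "z \<in> B" "\<And>y. y \<in> B \<Longrightarrow> F z + \<epsilon> * H z \<le> F y + \<epsilon> * H y"
      using continuous_attains_inf[OF \<open>compact B\<close>] \<open>q \<in> B\<close> by blast
    have "z \<notin> S"
    proof
      assume "z \<in> S"
      then have "\<delta> + \<epsilon> * H z \<le> \<epsilon> * H q"
        using \<delta>(2) z(2)[OF \<open>q \<in> B\<close>] zero by fastforce
      moreover have "\<epsilon> * H q \<le> \<epsilon> * M" "\<epsilon> * (- M) \<le> \<epsilon> * H z"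
        using M[OF \<open>q \<in> B\<close>] M[OF z(1)] \<epsilon> by (intro mult_left_mono; linarith)+
      moreover have "\<epsilon> * (2 * M + 1) = 2 * (\<epsilon> * M) + \<epsilon>"
        by (simp add: algebra_simps)
      ultimately show False
        using \<epsilon>' \<epsilon> by linarith
    qed
    have "F z + \<epsilon> * H z \<le> F y + \<epsilon> * H y" if "\<forall>i<d. \<bar>y i - q i\<bar> \<le> \<rho>" for y
    proof -
      \<comment> \<open>\<open>F\<close> and \<open>H\<close> see only the coordinates below
        \<open>d\<close>; resetting the others moves the point into \<open>B\<close>.\<close>
      let ?y = "\<lambda>i. if i < d then y i else q i"
      have "F ?y = F y" "H ?y = H y"
        by (auto intro: poly_fun_cong[OF F] poly_fun_cong[OF H])
      then show ?thesis
        using z(2)[of ?y] that by (simp add: in_B)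
    qed
    moreover have "\<forall>i<d. \<bar>z i - q i\<bar> < \<rho>"
      using z(1) \<open>z \<notin> S\<close> by (auto simp: S_def in_B less_le)
    ultimately show "\<exists>z. (\<forall>i<d. \<bar>z i - q i\<bar> < \<rho>) \<and>
      (\<forall>y. (\<forall>i<d. \<bar>y i - q i\<bar> \<le> \<rho>) \<longrightarrow> F z + \<epsilon> * H z \<le> F y + \<epsilon> * H y)"
      by blast
  qed
qed

text \<open>As \<open>Q\<close> is finite, one radius and one \<open>\<epsilon>\<close> serve all
  its points. Each \<open>q\<close> gets a local minimum \<open>z q\<close> in its own box, the
  boxes are disjoint, and the minima are critical points, counted by
  \<open>card_solutions_le\<close>.\<close>

lemma card_isolated_zeros_le:
  fixes F :: "(nat \<Rightarrow> real) \<Rightarrow> real"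
  assumes F: "poly_fun d m F" and "m > 0"
    and nonneg: "\<And>y. F y \<ge> 0"
    and "finite Q" and zero: "\<And>q. q \<in> Q \<Longrightarrow> F q = 0"
    and iso: "\<And>q. q \<in> Q \<Longrightarrow>
      \<exists>\<rho>>0. \<forall>y. (\<forall>i<d. \<bar>y i - q i\<bar> < \<rho>) \<longrightarrow> F y = 0 \<longrightarrow> (\<forall>i<d. y i = q i)"
    and dist: "\<And>q q'. q \<in> Q \<Longrightarrow> q' \<in> Q \<Longrightarrow> (\<And>i. i < d \<Longrightarrow> q i = q' i) \<Longrightarrow> q = q'"
  shows "card Q \<le> m ^ d"
proof -
  define H where "H = (\<lambda>y :: nat \<Rightarrow> real. \<Sum>j<d. y j ^ Suc m)"
  have H: "poly_fun d (Suc m) H"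
  proof -
    have "poly_fun d (Suc m) (\<lambda>y. \<Sum>j\<in>J. y j ^ Suc m)" if "J \<subseteq> {..<d}" for J
      using finite_subset[OF that finite_lessThan] that
    proof (induction J)
      case (insert j J)
      have "poly_fun d (card {..<Suc m} * Suc 0) (\<lambda>y. \<Prod>i\<in>{..<Suc m}. y j)"
        using insert by (intro poly_fun_prod poly_fun_var) auto
      with insert show ?case
        by (auto intro: poly_fun.add)
    qed (simp add: poly_fun_const)
    then show ?thesis
      by (simp add: H_def)
  qed
  from iso obtain r where r: "\<And>q. q \<in> Q \<Longrightarrow> r q > 0"
    "\<And>q y i. q \<in> Q \<Longrightarrow> (\<And>i. i < d \<Longrightarrow> \<bar>y i - q i\<bar> < r q) \<Longrightarrow> F y = 0 \<Longrightarrow> i < d \<Longrightarrow> y i = q i"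
    by metis
  define R where "R = Min (insert 1 (r ` Q))"
  have R: "R > 0" "\<And>q. q \<in> Q \<Longrightarrow> R \<le> r q"
    unfolding R_def using \<open>finite Q\<close> r(1) by auto
  \<comment> \<open>Zeros whose \<open>\<rho>\<close>-boxes meet are closer than
    \<open>2 * \<rho>\<close>, which is below the isolation radius, so they coincide. The closed box
    also stays within that radius.\<close>
  define \<rho> where "\<rho> = R / 3"
  have \<rho>: "\<rho> > 0" "\<And>q. q \<in> Q \<Longrightarrow> 3 * \<rho> \<le> r q"
    using R by (auto simp: \<rho>_def)
  have disjoint: "q = q'"
    if q: "q \<in> Q" "q' \<in> Q" and close: "\<And>i. i < d \<Longrightarrow> \<bar>z i - q i\<bar> < \<rho> \<and> \<bar>z i - q' i\<bar> < \<rho>"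
    for q q' and z :: "nat \<Rightarrow> real"
  proof (rule dist[OF q])
    have "\<bar>q i - q' i\<bar> < r q'" if "i < d" for i
      using close[OF that] \<rho>(2)[OF q(2)] \<rho>(1) by linarith
    then show "q i = q' i" if "i < d" for i
      using r(2)[OF q(2) _ zero[OF q(1)] that] by blast
  qed
  have "\<exists>\<epsilon>0>0. \<forall>\<epsilon>. 0 < \<epsilon> \<and> \<epsilon> < \<epsilon>0 \<longrightarrow>
    (\<exists>z. (\<forall>i<d. \<bar>z i - q i\<bar> < \<rho>) \<and>
      (\<forall>y. (\<forall>i<d. \<bar>y i - q i\<bar> \<le> \<rho>) \<longrightarrow> F z + \<epsilon> * H z \<le> F y + \<epsilon> * H y))" if "q \<in> Q" for q
  proof (rule perturbed_local_minimum[OF F H nonneg zero[OF that] \<rho>(1)])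
    fix y i
    assume y: "\<And>i. i < d \<Longrightarrow> \<bar>y i - q i\<bar> \<le> \<rho>" "F y = 0" "i < d"
    have "\<bar>y i - q i\<bar> < r q" if "i < d" for i
      using y(1)[OF that] \<rho>(1) \<rho>(2)[OF \<open>q \<in> Q\<close>] by linarith
    then show "y i = q i"
      using r(2)[OF that _ y(2,3)] by blast
  qed
  then obtain e where e: "\<And>q. q \<in> Q \<Longrightarrow> e q > 0"
    "\<And>q \<epsilon>. q \<in> Q \<Longrightarrow> 0 < \<epsilon> \<Longrightarrow> \<epsilon> < e q \<Longrightarrow>
      \<exists>z. (\<forall>i<d. \<bar>z i - q i\<bar> < \<rho>) \<and>
      (\<forall>y. (\<forall>i<d. \<bar>y i - q i\<bar> \<le> \<rho>) \<longrightarrow> F z + \<epsilon> * H z \<le> F y + \<epsilon> * H y)"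
    by metis
  define \<epsilon>1 where "\<epsilon>1 = Min (insert 1 (e ` Q))"
  have \<epsilon>1: "\<epsilon>1 > 0" "\<And>q. q \<in> Q \<Longrightarrow> \<epsilon>1 \<le> e q"
    unfolding \<epsilon>1_def using \<open>finite Q\<close> e(1) by auto
  define \<epsilon> where "\<epsilon> = \<epsilon>1 / 2"
  have \<epsilon>: "\<epsilon> > 0" "\<And>q. q \<in> Q \<Longrightarrow> \<epsilon> < e q"
    using \<epsilon>1 by (auto simp: \<epsilon>_def dest!: \<epsilon>1(2))
  obtain z where z: "\<And>q i. q \<in> Q \<Longrightarrow> i < d \<Longrightarrow> \<bar>z q i - q i\<bar> < \<rho>"
    "\<And>q y. q \<in> Q \<Longrightarrow> (\<And>i. i < d \<Longrightarrow> \<bar>y i - q i\<bar> \<le> \<rho>) \<Longrightarrow>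
      F (z q) + \<epsilon> * H (z q) \<le> F y + \<epsilon> * H y"
    using e(2)[OF _ \<epsilon>(1) \<epsilon>(2)] by metis
  have "poly_fun d (Suc (m - 1)) F"
    using F \<open>m > 0\<close> by simp
  then obtain g where g: "\<And>i. i < d \<Longrightarrow> poly_fun d (m - 1) (g i)"
    "\<And>i y. i < d \<Longrightarrow> ((\<lambda>s. F (y(i := s))) has_real_derivative g i y) (at (y i))"
    using poly_fun_partial_derivative by metis
  have critical: "z q i ^ m = - 1 / (\<epsilon> * real (Suc m)) * g i (z q)" if "q \<in> Q" "i < d" for q i
  proof -
    have ins: "{..<d} = insert i ({..<d} - {i})"
      using that by auto
    have H_eq: "H ((z q)(i := s)) = s ^ Suc m + (\<Sum>j\<in>{..<d} - {i}. z q j ^ Suc m)" for s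
      unfolding H_def by (subst ins) (subst sum.insert, auto)
    have "((\<lambda>s. F ((z q)(i := s)) + \<epsilon> * H ((z q)(i := s))) has_real_derivative
        g i (z q) + \<epsilon> * (real (Suc m) * z q i ^ m)) (at (z q i))"
      unfolding H_eq
      by (intro DERIV_add g(2) that DERIV_cmult)
        (use \<open>m > 0\<close> in \<open>auto intro!: derivative_eq_intros
          simp: algebra_simps power_minus_mult simp flip: power_Suc\<close>)
    \<comment> \<open>This is the distance from \<open>z q i\<close> to the nearer wall of the box:
      a smaller change of coordinate \<open>i\<close> stays in the box.\<close>
    moreover have "\<rho> - \<bar>z q i - q i\<bar> > 0"
      using z(1)[OF that] by simp
    moreover have "\<forall>s. \<bar>z q i - s\<bar> < \<rho> - \<bar>z q i - q i\<bar> \<longrightarrow>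
        F ((z q)(i := z q i)) + \<epsilon> * H ((z q)(i := z q i)) \<le>
        F ((z q)(i := s)) + \<epsilon> * H ((z q)(i := s))"
    proof (intro allI impI)
      fix s assume s: "\<bar>z q i - s\<bar> < \<rho> - \<bar>z q i - q i\<bar>"
      have "\<bar>((z q)(i := s)) j - q j\<bar> \<le> \<rho>" if "j < d" for j
        using s z(1)[OF \<open>q \<in> Q\<close> that] by auto
      then show "F ((z q)(i := z q i)) + \<epsilon> * H ((z q)(i := z q i)) \<le>
          F ((z q)(i := s)) + \<epsilon> * H ((z q)(i := s))"
        using z(2)[OF \<open>q \<in> Q\<close>] by simp
    qed
    ultimately have "g i (z q) + \<epsilon> * (real (Suc m) * z q i ^ m) = 0"
      by (rule DERIV_local_min)
    then have "(\<epsilon> * real (Suc m)) * z q i ^ m = - g i (z q)"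
      by (simp add: algebra_simps)
    moreover have "\<epsilon> * real (Suc m) \<noteq> 0"
      using \<epsilon>(1) by simp
    ultimately show ?thesis
      by (metis divide_inverse mult.commute mult_1 nonzero_mult_div_cancel_left
          minus_mult_commute)
  qed
  have inj: "inj_on z Q"
    using disjoint z(1) by (metis inj_onI)
  have "card (z ` Q) \<le> m ^ d"
  proof (rule card_solutions_le[OF _ \<open>m > 0\<close>])
    show "poly_fun d (m - 1) (\<lambda>y. - 1 / (\<epsilon> * real (Suc m)) * g i y)" if "i < d" for i
      by (intro poly_fun_scale g(1) that)
    show "y i ^ m = - 1 / (\<epsilon> * real (Suc m)) * g i y" if "y \<in> z ` Q" "i < d" for y i
      using critical that by blast
    show "y = y'" if "y \<in> z ` Q" "y' \<in> z ` Q" "\<And>i. i < d \<Longrightarrow> y i = y' i" for y y'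
    proof -
      from that obtain q q' where "q \<in> Q" "q' \<in> Q" "y = z q" "y' = z q'"
        by blast
      with that(3) z(1) disjoint[of q q' "z q"] show ?thesis
        by metis
    qed
  qed (use \<open>finite Q\<close> in simp)
  then show ?thesis
    by (simp add: card_image[OF inj])
qed

subsection \<open>Computation trees\<close>

text \<open>A basic open neighbourhood may restrict coordinates from \<open>d\<close> on as well. By
  \<open>cong\<close> these can be overwritten by those of \<open>q\<close>, and the least of the
  remaining finitely many radii works.\<close>

lemma open_contains_box:
  fixes U :: "(nat \<Rightarrow> real) set"
  assumes "open U" "q \<in> U"
    and cong: "\<And>y y'. y \<in> U \<Longrightarrow> (\<And>i. i < d \<Longrightarrow> y i = y' i) \<Longrightarrow> y' \<in> U"
  shows "\<exists>\<rho>>0. \<forall>y. (\<forall>i<d. \<bar>y i - q i\<bar> < \<rho>) \<longrightarrow> y \<in> U"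
proof -
  obtain X where X: "q \<in> PiE UNIV X" "\<And>i. open (X i)" "PiE UNIV X \<subseteq> U"
    using product_topology_open_contains_basis[of "\<lambda>_. euclidean" UNIV U q] assms(1,2)
    by (auto simp: open_fun_def)
  have "\<exists>\<epsilon>>0. \<forall>s. \<bar>s - q i\<bar> < \<epsilon> \<longrightarrow> s \<in> X i" for i
    using X(1,2) unfolding open_dist dist_real_def by (metis PiE_mem UNIV_I)
  then obtain \<epsilon> where \<epsilon>: "\<And>i. \<epsilon> i > 0" "\<And>i s. \<bar>s - q i\<bar> < \<epsilon> i \<Longrightarrow> s \<in> X i"
    by metis
  define \<rho> where "\<rho> = Min (insert 1 (\<epsilon> ` {..<d}))"
  have "\<rho> > 0" "\<And>i. i < d \<Longrightarrow> \<rho> \<le> \<epsilon> i"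
    unfolding \<rho>_def using \<epsilon>(1) by auto
  moreover have "y \<in> U" if "\<forall>i<d. \<bar>y i - q i\<bar> < \<rho>" for y
  proof -
    let ?y = "\<lambda>i. if i < d then y i else q i"
    have "?y i \<in> X i" for i
      using that \<open>\<And>i. i < d \<Longrightarrow> \<rho> \<le> \<epsilon> i\<close> \<epsilon>(2)[of "y i" i] X(1) by fastforce
    then have "?y \<in> U"
      using X(3) by auto
    then show ?thesis
      by (rule cong) auto
  qed
  ultimately show ?thesis
    by blast
qed

text \<open>This separates counting from geometry: \<open>v\<close> real parameters enter the tree
  through affine \<open>inputs\<close>, and each point of \<open>I\<close> is isolated among the
  parameters with the same answer.\<close>

locale isolated_instances =
  fixes v :: nat and inputs :: "((nat \<Rightarrow> real) \<Rightarrow> real) list"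
    and answer :: "(nat \<Rightarrow> real) \<Rightarrow> bool" and I :: "(nat \<Rightarrow> real) set"
  assumes inputs: "f \<in> set inputs \<Longrightarrow> poly_fun v 1 f"
    and answer_cong: "(\<And>i. i < v \<Longrightarrow> y i = y' i) \<Longrightarrow> answer y = answer y'"
    and finite_I: "finite I"
    and eq_I: "\<lbrakk>g \<in> I; g' \<in> I; \<And>i. i < v \<Longrightarrow> g i = g' i\<rbrakk> \<Longrightarrow> g = g'"
    and isolated: "g \<in> I \<Longrightarrow> \<exists>\<rho>>0. \<forall>y. (\<forall>i<v. \<bar>y i - g i\<bar> < \<rho>) \<longrightarrow>
      answer y = answer g \<longrightarrow> (\<forall>i<v. y i = g i)"
begin

text \<open>A point \<open>y\<close> records the \<open>v\<close> variables in its coordinates below \<open>v\<close> and the results of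
  the computation nodes in the coordinates from \<open>v\<close> on.\<close>

definition input_vals :: "(nat \<Rightarrow> real) \<Rightarrow> real list" where
  "input_vals y = map (\<lambda>f. f y) inputs"

definition results :: "nat \<Rightarrow> (nat \<Rightarrow> real) \<Rightarrow> real list" where
  "results r y = map (\<lambda>j. y (v + j)) [0..<r]"

abbreviation operand_at :: "nat \<Rightarrow> operand \<Rightarrow> (nat \<Rightarrow> real) \<Rightarrow> real" where
  "operand_at r a y \<equiv> operand_val (input_vals y) (results r y) a"

text \<open>The zeros of \<open>F\<close> in \<open>U\<close> are the states in which the computation arrives at the subtree \<open>T\<close>
  along a path with prescribed signs; by the last clause they form a graph over the variables.\<close>

definition describes ::
  "nat \<Rightarrow> ((nat \<Rightarrow> real) \<Rightarrow> real) \<Rightarrow> (nat \<Rightarrow> real) set \<Rightarrow> ctree \<Rightarrow> bool" where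
  "describes r F U T \<longleftrightarrow> wf_ctree (length inputs) r T \<and>
     poly_fun (v + r) 4 F \<and> (\<forall>y. F y \<ge> 0) \<and>
     open U \<and> (\<forall>y y'. y \<in> U \<longrightarrow> (\<forall>i<v + r. y i = y' i) \<longrightarrow> y' \<in> U) \<and>
     (\<forall>y\<in>U. F y = 0 \<longrightarrow> run T (input_vals y) (results r y) = Some (answer y)) \<and>
     (\<forall>y\<in>U. \<forall>y'\<in>U. F y = 0 \<longrightarrow> F y' = 0 \<longrightarrow> (\<forall>i<v. y i = y' i) \<longrightarrow> (\<forall>i<v + r. y i = y' i))"

text \<open>For \<open>F\<close> and \<open>U\<close> as in \<open>describes\<close>, these are the
  isolated instances whose computation follows the path.\<close>

definition reached :: "((nat \<Rightarrow> real) \<Rightarrow> real) \<Rightarrow> (nat \<Rightarrow> real) set \<Rightarrow> (nat \<Rightarrow> real) set" where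
  "reached F U = {g \<in> I. \<exists>y\<in>U. F y = 0 \<and> (\<forall>i<v. y i = g i)}"

lemma describesD:
  assumes "describes r F U T"
  shows "wf_ctree (length inputs) r T" "poly_fun (v + r) 4 F" "F y \<ge> 0" "open U"
    "y \<in> U \<Longrightarrow> (\<And>i. i < v + r \<Longrightarrow> y i = y' i) \<Longrightarrow> y' \<in> U"
    "y \<in> U \<Longrightarrow> F y = 0 \<Longrightarrow> run T (input_vals y) (results r y) = Some (answer y)"
    "\<lbrakk>y \<in> U; y' \<in> U; F y = 0; F y' = 0; \<And>i. i < v \<Longrightarrow> y i = y' i; i < v + r\<rbrakk> \<Longrightarrow> y i = y' i"
  using assms unfolding describes_def by blast+

lemma describesI:
  assumes "wf_ctree (length inputs) r T" "poly_fun (v + r) 4 F" "\<And>y. F y \<ge> 0" "open U"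
    and "\<And>y y'. y \<in> U \<Longrightarrow> (\<And>i. i < v + r \<Longrightarrow> y i = y' i) \<Longrightarrow> y' \<in> U"
    and "\<And>y. y \<in> U \<Longrightarrow> F y = 0 \<Longrightarrow> run T (input_vals y) (results r y) = Some (answer y)"
    and "\<And>y y' i. \<lbrakk>y \<in> U; y' \<in> U; F y = 0; F y' = 0; \<And>i. i < v \<Longrightarrow> y i = y' i; i < v + r\<rbrakk> \<Longrightarrow> y i = y' i"
  shows "describes r F U T"
  using assms unfolding describes_def by blast

lemma finite_reached: "finite (reached F U)"
  using finite_I by (simp add: reached_def)

lemma input_vals_cong: "(\<And>i. i < v \<Longrightarrow> y i = y' i) \<Longrightarrow> input_vals y = input_vals y'"
  by (auto simp: input_vals_def intro: poly_fun_cong inputs)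

lemma results_cong: "(\<And>i. i < v + r \<Longrightarrow> y i = y' i) \<Longrightarrow> results r y = results r y'"
  by (auto simp: results_def)

lemma results_Suc: "results (Suc r) y = results r y @ [y (v + r)]"
  by (simp add: results_def)

lemma poly_fun_operand:
  assumes "wf_operand (length inputs) r a"
  shows "poly_fun (v + r) 1 (operand_at r a)"
proof (cases a)
  case (Input i)
  with assms have "poly_fun v 1 (inputs ! i)"
    by (intro inputs) simp
  then have "poly_fun (v + r) 1 (inputs ! i)"
    by (rule poly_fun_mono) auto
  with Input assms show ?thesis
    by (simp add: input_vals_def)
next
  case (Const c)
  then show ?thesis
    by (simp add: poly_fun_const)
next
  case (Result j)
  with assms poly_fun_var[of "v + j" "v + r" 0] show ?thesis
    by (simp add: results_def)
qed

section \<open>Extending path descriptions by one node\<close>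

lemma open_positive: "poly_fun d k N \<Longrightarrow> open {y. N y > 0}"
  by (intro open_Collect_less continuous_on_const continuous_on_poly_fun)

text \<open>A sign condition is an equation \<open>S y = 0\<close>, absorbed into the sum
  \<open>F\<close> of nonnegative functions, together with a strict inequality, absorbed into the
  open set. The constants \<open>S = 0\<close> and \<open>N = 1\<close> impose nothing.\<close>

lemma describes_branch:
  assumes desc: "describes r F U (Branch s a t u)"
    and S: "poly_fun (v + r) 4 S" "\<And>y. S y \<ge> 0" and N: "poly_fun (v + r) k N"
    and sign: "\<And>y. S y = 0 \<Longrightarrow> N y > 0 \<Longrightarrow> passes s (operand_at r a y) \<longleftrightarrow> b"
  shows "describes r (\<lambda>y. F y + S y) (U \<inter> {y. N y > 0}) (if b then t else u)"
proof (rule describesI)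
  note D = describesD[OF desc]
  have zero: "F y + S y = 0 \<longleftrightarrow> F y = 0 \<and> S y = 0" for y
    using D(3)[of y] S(2)[of y] by (simp add: add_nonneg_eq_0_iff)
  show "wf_ctree (length inputs) r (if b then t else u)"
    using D(1) by simp
  show "poly_fun (v + r) 4 (\<lambda>y. F y + S y)"
    by (intro poly_fun.add D(2) S(1))
  show "F y + S y \<ge> 0" for y
    by (intro add_nonneg_nonneg D(3) S(2))
  show "open (U \<inter> {y. N y > 0})"
    by (intro open_Int D(4) open_positive[OF N])
  show "y' \<in> U \<inter> {y. N y > 0}"
    if "y \<in> U \<inter> {y. N y > 0}" "\<And>i. i < v + r \<Longrightarrow> y i = y' i" for y y'
    using that D(5)[of y y'] poly_fun_cong[OF N, of y y'] by simp
  show "run (if b then t else u) (input_vals y) (results r y) = Some (answer y)"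
    if "y \<in> U \<inter> {y. N y > 0}" "F y + S y = 0" for y
    using that D(6)[of y] sign[of y] by (cases b) (simp_all add: zero)
  show "y i = y' i"
    if "y \<in> U \<inter> {y. N y > 0}" "y' \<in> U \<inter> {y. N y > 0}" "F y + S y = 0" "F y' + S y' = 0"
      "\<And>i. i < v \<Longrightarrow> y i = y' i" "i < v + r" for y y' i
    using that D(7)[of y y' i] by (simp add: zero)
qed

text \<open>Coordinate \<open>v + r\<close> becomes the new result. By \<open>val\<close> it is a
  function of the earlier coordinates, so the zeros remain a graph over the variables.\<close>

lemma describes_compute:
  assumes desc: "describes r F U (Compute f t)"
    and S: "poly_fun (v + Suc r) 4 S" "\<And>y. S y \<ge> 0" and N: "poly_fun (v + Suc r) k N"
    and val: "\<And>y. S y = 0 \<Longrightarrow> N y > 0 \<Longrightarrow>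
      operation_val (input_vals y) (results r y) f = Some (y (v + r))"
  shows "describes (Suc r) (\<lambda>y. F y + S y) (U \<inter> {y. N y > 0}) t"
proof (rule describesI)
  note D = describesD[OF desc]
  have zero: "F y + S y = 0 \<longleftrightarrow> F y = 0 \<and> S y = 0" for y
    using D(3)[of y] S(2)[of y] by (simp add: add_nonneg_eq_0_iff)
  show "wf_ctree (length inputs) (Suc r) t"
    using D(1) by simp
  have "poly_fun (v + Suc r) 4 F"
    using D(2) by (rule poly_fun_mono) auto
  then show "poly_fun (v + Suc r) 4 (\<lambda>y. F y + S y)"
    using S(1) by (rule poly_fun.add)
  show "F y + S y \<ge> 0" for y
    by (intro add_nonneg_nonneg D(3) S(2))
  show "open (U \<inter> {y. N y > 0})"
    by (intro open_Int D(4) open_positive[OF N])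
  show "y' \<in> U \<inter> {y. N y > 0}"
    if "y \<in> U \<inter> {y. N y > 0}" "\<And>i. i < v + Suc r \<Longrightarrow> y i = y' i" for y y'
    using that D(5)[of y y'] poly_fun_cong[OF N, of y y'] by simp
  show "run t (input_vals y) (results (Suc r) y) = Some (answer y)"
    if "y \<in> U \<inter> {y. N y > 0}" "F y + S y = 0" for y
    using that D(6)[of y] val[of y] by (simp add: zero results_Suc)
  show "y i = y' i"
    if "y \<in> U \<inter> {y. N y > 0}" "y' \<in> U \<inter> {y. N y > 0}" "F y + S y = 0" "F y' + S y' = 0"
      "\<And>i. i < v \<Longrightarrow> y i = y' i" "i < v + Suc r" for y y' i
  proof -
    have *: "y i = y' i" if "i < v + r" for i
      using \<open>y \<in> _\<close> \<open>y' \<in> _\<close> \<open>F y + S y = 0\<close> \<open>F y' + S y' = 0\<close> \<open>\<And>i. i < v \<Longrightarrow> y i = y' i\<close> that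
        D(7)[of y y' i] by (simp add: zero)
    then have "input_vals y = input_vals y'" "results r y = results r y'"
      by (auto intro: input_vals_cong results_cong)
    then have "y (v + r) = y' (v + r)"
      using val[of y] val[of y'] that by (simp add: zero)
    with * that(6) show ?thesis
      by (cases "i = v + r") auto
  qed
qed

text \<open>The run ends in an answer, so the operation does not abort. Its value can be written
  into coordinate \<open>v + r\<close>, which neither \<open>F\<close> nor \<open>U\<close>
  sees.\<close>

lemma reached_compute:
  assumes desc: "describes r F U (Compute f t)" and "g \<in> reached F U"
  obtains y where "g \<in> I" "y \<in> U" "F y = 0" "\<And>i. i < v \<Longrightarrow> y i = g i"
    "operation_val (input_vals y) (results r y) f = Some (y (v + r))"
proof -
  obtain y where y: "g \<in> I" "y \<in> U" "F y = 0" "\<forall>i<v. y i = g i"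
    using assms(2) by (auto simp: reached_def)
  have "run (Compute f t) (input_vals y) (results r y) = Some (answer y)"
    by (rule describesD(6)[OF desc y(2,3)])
  then obtain w where w: "operation_val (input_vals y) (results r y) f = Some w"
    by (auto split: option.splits)
  let ?y = "y(v + r := w)"
  have agree: "\<And>i. i < v + r \<Longrightarrow> y i = ?y i"
    by simp
  have "?y \<in> U"
    by (rule describesD(5)[OF desc y(2) agree])
  moreover have "F y = F ?y"
    by (rule poly_fun_cong[OF describesD(2)[OF desc] agree])
  moreover have "input_vals y = input_vals ?y" "results r y = results r ?y"
    by (auto intro: input_vals_cong results_cong)
  ultimately show ?thesis
    using that[of ?y] y w by simp
qed

text \<open>At a leaf all zeros of \<open>F\<close> in \<open>U\<close> have the same answer. A zero
  near \<open>p g\<close> thus agrees with \<open>g\<close> in the variables by isolation, and with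
  \<open>p g\<close> in the results by the graph property. So the points \<open>p g\<close> are
  isolated zeros of a polynomial of degree \<open>4\<close>.\<close>

lemma card_reached_leaf:
  assumes desc: "describes r F U (Leaf b)"
  shows "card (reached F U) \<le> 4 ^ (v + r)"
proof -
  have "\<forall>g\<in>reached F U. \<exists>y\<in>U. F y = 0 \<and> (\<forall>i<v. y i = g i)"
    by (simp add: reached_def)
  then obtain p where p: "\<And>g. g \<in> reached F U \<Longrightarrow> p g \<in> U"
    "\<And>g. g \<in> reached F U \<Longrightarrow> F (p g) = 0"
    "\<And>g i. g \<in> reached F U \<Longrightarrow> i < v \<Longrightarrow> p g i = g i"
    by metis
  have agree: "g = g'"
    if "g \<in> reached F U" "g' \<in> reached F U" "\<And>i. i < v \<Longrightarrow> p g i = p g' i" for g g'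
    using that p(3) by (intro eq_I) (auto simp: reached_def)
  have answer: "answer y = b" if "y \<in> U" "F y = 0" for y
    using describesD(6)[OF desc that] by simp
  have "card (p ` reached F U) \<le> 4 ^ (v + r)"
  proof (rule card_isolated_zeros_le)
    show "poly_fun (v + r) 4 F" "F y \<ge> 0" for y
      by (rule describesD[OF desc])+
    show "F q = 0" if "q \<in> p ` reached F U" for q
      using that p by auto
    show "\<exists>\<rho>>0. \<forall>y. (\<forall>i<v + r. \<bar>y i - q i\<bar> < \<rho>) \<longrightarrow> F y = 0 \<longrightarrow> (\<forall>i<v + r. y i = q i)"
      if "q \<in> p ` reached F U" for q
    proof -
      obtain g where g: "g \<in> reached F U" "q = p g"
        using \<open>q \<in> p ` reached F U\<close> by blast
      obtain \<rho>1 where \<rho>1: "\<rho>1 > 0" "\<And>y. \<forall>i<v + r. \<bar>y i - q i\<bar> < \<rho>1 \<Longrightarrow> y \<in> U"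
        using open_contains_box[OF describesD(4)[OF desc], of q "v + r"] describesD(5)[OF desc] g p(1)
        by blast
      obtain \<rho>2 where \<rho>2: "\<rho>2 > 0"
        "\<And>y. \<forall>i<v. \<bar>y i - g i\<bar> < \<rho>2 \<Longrightarrow> answer y = answer g \<Longrightarrow> \<forall>i<v. y i = g i"
        using isolated[of g] g(1) by (auto simp: reached_def)
      have "answer g = answer q"
        using g p(3) by (intro answer_cong) simp
      have "\<forall>i<v + r. y i = q i" if y: "\<forall>i<v + r. \<bar>y i - q i\<bar> < min \<rho>1 \<rho>2" "F y = 0" for y
      proof -
        have "y \<in> U"
          using y \<rho>1 by simp
        moreover have "q \<in> U" "F q = 0"
          using g p by auto
        moreover have "answer y = answer g"
          using calculation y(2) answer \<open>answer g = answer q\<close> by simp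
        moreover have "y i = q i" if "i < v" for i
        proof -
          have "\<bar>y j - g j\<bar> < \<rho>2" if "j < v" for j
            using y(1)[rule_format, of j] p(3)[OF g(1) that] g(2) that by simp
          then have "y i = g i"
            using \<rho>2(2) \<open>answer y = answer g\<close> that by blast
          then show ?thesis
            using p(3)[OF g(1) that] g(2) by simp
        qed
        ultimately show ?thesis
          using describesD(7)[OF desc] y(2) by blast
      qed
      moreover have "min \<rho>1 \<rho>2 > 0"
        using \<rho>1(1) \<rho>2(1) by simp
      ultimately show ?thesis
        by blast
    qed
    show "q = q'"
      if qq: "q \<in> p ` reached F U" "q' \<in> p ` reached F U" "\<And>i. i < v + r \<Longrightarrow> q i = q' i" for q q'
    proof -
      obtain g g' where "g \<in> reached F U" "q = p g" "g' \<in> reached F U" "q' = p g'"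
        using qq(1,2) by blast
      with qq(3) agree[of g g'] show ?thesis
        by simp
    qed
  qed (simp_all add: finite_reached)
  moreover have "inj_on p (reached F U)"
    by (auto intro!: inj_onI agree)
  ultimately show ?thesis
    by (simp add: card_image)
qed

text \<open>A branch splits the instances into three sign classes, a computation into at most two,
  which accounts for a factor \<open>3\<close> per level. The new variable of a computation accounts
  for a factor \<open>4\<close>.\<close>

lemma card_reached_le:
  "describes r F U T \<Longrightarrow> card (reached F U) \<le> 3 ^ complexity T * 4 ^ (v + r + complexity T)"
proof (induction T arbitrary: r F U)
  case (Leaf b)
  then show ?case
    using card_reached_leaf by simp
next
  case (Compute f t)
  note wf = Compute.prems[THEN describesD(1)]
  let ?b = "3 ^ complexity t * 4 ^ (v + Suc r + complexity t) :: nat"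
  let ?op = "\<lambda>y. operation_val (input_vals y) (results r y) f"
  have A: "poly_fun (v + Suc r) 1 (operand_at r a)" if "wf_operand (length inputs) r a" for a
    using poly_fun_operand[OF that] by (rule poly_fun_mono) auto
  have AA: "poly_fun (v + Suc r) 2 (operand_at r a)" if "wf_operand (length inputs) r a" for a
    using A[OF that] by (rule poly_fun_mono) auto
  have Y1: "poly_fun (v + Suc r) 1 (\<lambda>y. y (v + r))"
    using poly_fun_var[of "v + r" "v + Suc r" 0] by simp
  have Y: "poly_fun (v + Suc r) 2 (\<lambda>y. y (v + r))"
    using Y1 by (rule poly_fun_mono) auto
  have mult: "poly_fun (v + Suc r) 2 (\<lambda>y. g y * h y)"
    if "poly_fun (v + Suc r) 1 g" "poly_fun (v + Suc r) 1 h" for g h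
    using poly_fun_mult[OF that] by (simp add: numeral_2_eq_2)
  have square: "poly_fun (v + Suc r) 4 (\<lambda>y. (g y)\<^sup>2)" if "poly_fun (v + Suc r) 2 g" for g
    using poly_fun_square[OF that] by simp
  \<comment> \<open>This covers the operations whose graph is given by one equation of degree
    \<open>2\<close>, squared to degree \<open>4\<close>, and one strict inequality.\<close>
  have one: "card (reached F U) \<le> ?b"
    if "poly_fun (v + Suc r) 2 P" "poly_fun (v + Suc r) k N"
      and "\<And>y. ?op y = Some (y (v + r)) \<longleftrightarrow> P y = 0 \<and> N y > 0" for P N k
  proof -
    let ?F = "\<lambda>y. F y + (P y)\<^sup>2" and ?U = "U \<inter> {y. N y > 0}"
    have "describes (Suc r) ?F ?U t"
      by (rule describes_compute[OF Compute.prems square[OF that(1)] _ that(2)])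
        (simp_all add: that(3))
    then have "card (reached ?F ?U) \<le> ?b"
      by (rule Compute.IH)
    moreover have "reached F U \<subseteq> reached ?F ?U"
    proof
      fix g assume "g \<in> reached F U"
      then obtain y where "g \<in> I" "y \<in> U" "F y = 0" "\<And>i. i < v \<Longrightarrow> y i = g i"
        "?op y = Some (y (v + r))"
        using reached_compute[OF Compute.prems] by blast
      with that(3)[of y] show "g \<in> reached ?F ?U"
        unfolding reached_def by (intro CollectI conjI bexI[of _ y]) auto
    qed
    ultimately show ?thesis
      using card_mono[OF finite_reached] le_trans by blast
  qed
  have "card (reached F U) \<le> 2 * ?b"
  proof (cases f)
    case (Add a b)
    have "card (reached F U) \<le> ?b"
      using wf Add by (intro one[of "\<lambda>y. operand_at r a y + operand_at r b y - y (v + r)" 0 "\<lambda>_. 1"])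
        (auto intro!: poly_fun_diff poly_fun.add AA Y poly_fun_const simp del: add_Suc_right)
    then show ?thesis
      by simp
  next
    case (Sub a b)
    have "card (reached F U) \<le> ?b"
      using wf Sub by (intro one[of "\<lambda>y. operand_at r a y - operand_at r b y - y (v + r)" 0 "\<lambda>_. 1"])
        (auto intro!: poly_fun_diff AA Y poly_fun_const simp del: add_Suc_right)
    then show ?thesis
      by simp
  next
    case (Mul a b)
    have "card (reached F U) \<le> ?b"
      using wf Mul by (intro one[of "\<lambda>y. operand_at r a y * operand_at r b y - y (v + r)" 0 "\<lambda>_. 1"])
        (auto intro!: poly_fun_diff mult A Y poly_fun_const simp del: add_Suc_right)
    then show ?thesis
      by simp
  next
    case (Div a b)
    \<comment> \<open>The equation is multiplied by the denominator, and the denominator being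
      nonzero is the open condition that its square is positive.\<close>
    have "card (reached F U) \<le> ?b"
      using wf Div by (intro one[of "\<lambda>y. y (v + r) * operand_at r b y - operand_at r a y" 4
          "\<lambda>y. (operand_at r b y)\<^sup>2"])
        (auto intro!: poly_fun_diff mult A AA Y1 square simp: divide_eq_eq simp del: add_Suc_right)
    then show ?thesis
      by simp
  next
    case (Sqrt a)
    with wf have a: "wf_operand (length inputs) r a"
      by simp
    \<comment> \<open>A root is determined by its square and \<open>y (v + r) \<ge> 0\<close>, which
      is not an open condition. It is split into the case where root and radicand are zero and the
      case of a positive root.\<close>
    let ?F0 = "\<lambda>y. F y + ((operand_at r a y)\<^sup>2 + (y (v + r))\<^sup>2)" and ?U0 = "U \<inter> {y. (1::real) > 0}"
    let ?F1 = "\<lambda>y. F y + ((y (v + r) * y (v + r) - operand_at r a y)\<^sup>2)"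
    let ?U1 = "U \<inter> {y. y (v + r) > 0}"
    have "describes (Suc r) ?F0 ?U0 t"
      using Sqrt by (intro describes_compute[OF Compute.prems, where k = 0])
        (auto intro!: square poly_fun.add AA a Y poly_fun_const simp: add_nonneg_eq_0_iff simp del: add_Suc_right)
    then have 0: "card (reached ?F0 ?U0) \<le> ?b"
      by (rule Compute.IH)
    have "describes (Suc r) ?F1 ?U1 t"
    proof (rule describes_compute[OF Compute.prems _ _ Y])
      show "poly_fun (v + Suc r) 4 (\<lambda>y. (y (v + r) * y (v + r) - operand_at r a y)\<^sup>2)"
        by (intro square poly_fun_diff mult Y1 AA a)
      fix y assume *: "(y (v + r) * y (v + r) - operand_at r a y)\<^sup>2 = 0" "0 < y (v + r)"
      then have "operand_at r a y = (y (v + r))\<^sup>2"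
        by (simp add: power2_eq_square)
      with * show "?op y = Some (y (v + r))"
        by (simp add: Sqrt)
    qed simp
    then have 1: "card (reached ?F1 ?U1) \<le> ?b"
      by (rule Compute.IH)
    have "reached F U \<subseteq> reached ?F0 ?U0 \<union> reached ?F1 ?U1"
    proof
      fix g assume "g \<in> reached F U"
      then obtain y where y: "g \<in> I" "y \<in> U" "F y = 0" "\<And>i. i < v \<Longrightarrow> y i = g i"
        "?op y = Some (y (v + r))"
        using reached_compute[OF Compute.prems] by blast
      then have op: "operand_at r a y \<ge> 0" "sqrt (operand_at r a y) = y (v + r)"
        by (auto simp: Sqrt split: if_splits)
      show "g \<in> reached ?F0 ?U0 \<union> reached ?F1 ?U1"
      proof (cases "operand_at r a y = 0")
        case True
        with y op have "g \<in> reached ?F0 ?U0"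
          unfolding reached_def by (intro CollectI conjI bexI[of _ y]) auto
        then show ?thesis ..
      next
        case False
        then have "y (v + r) > 0" "y (v + r) * y (v + r) = operand_at r a y"
          using op by (auto simp flip: op(2))
        with y have "g \<in> reached ?F1 ?U1"
          unfolding reached_def by (intro CollectI conjI bexI[of _ y]) auto
        then show ?thesis ..
      qed
    qed
    then have "card (reached F U) \<le> card (reached ?F0 ?U0 \<union> reached ?F1 ?U1)"
      by (intro card_mono) (simp_all add: finite_reached)
    also have "\<dots> \<le> card (reached ?F0 ?U0) + card (reached ?F1 ?U1)"
      by (rule card_Un_le)
    finally show ?thesis
      using 0 1 by linarith
  qed
  then show ?case
    by simp
next
  case (Branch s a t u)
  note wf = Branch.prems[THEN describesD(1)]
  define c where "c = max (complexity t) (complexity u)"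
  let ?b = "3 ^ c * 4 ^ (v + r + c) :: nat"
  have A: "poly_fun (v + r) 1 (operand_at r a)"
    using wf by (intro poly_fun_operand) simp
  have part: "card (reached (\<lambda>y. F y + S y) (U \<inter> {y. N y > 0})) \<le> ?b"
    if "poly_fun (v + r) 4 S" "\<And>y. S y \<ge> 0" "poly_fun (v + r) 1 N"
      and "\<And>y. S y = 0 \<Longrightarrow> N y > 0 \<Longrightarrow> passes s (operand_at r a y) \<longleftrightarrow> b" for S N b
  proof -
    have "describes r (\<lambda>y. F y + S y) (U \<inter> {y. N y > 0}) (if b then t else u)"
      by (rule describes_branch[OF Branch.prems that])
    then have "card (reached (\<lambda>y. F y + S y) (U \<inter> {y. N y > 0})) \<le>
        3 ^ complexity (if b then t else u) * 4 ^ (v + r + complexity (if b then t else u))"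
      using Branch.IH by (cases b) auto
    also have "\<dots> \<le> ?b"
      by (intro mult_mono power_increasing) (auto simp: c_def)
    finally show ?thesis .
  qed
  \<comment> \<open>Within a sign class every test has a constant outcome, read off at the sample
    values \<open>1\<close>, \<open>0\<close> and \<open>-1\<close>; it selects the subtree that the
    class enters.\<close>
  let ?R1 = "reached (\<lambda>y. F y + 0) (U \<inter> {y. operand_at r a y > 0})"
  let ?R2 = "reached (\<lambda>y. F y + (operand_at r a y)\<^sup>2) (U \<inter> {y. (1::real) > 0})"
  let ?R3 = "reached (\<lambda>y. F y + 0) (U \<inter> {y. 0 - operand_at r a y > 0})"
  have 1: "card ?R1 \<le> ?b"
    by (rule part[OF poly_fun_const _ A, where b = "passes s 1"]) (cases s; simp)+
  have "poly_fun (v + r) 4 (\<lambda>y. (operand_at r a y)\<^sup>2)"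
    using poly_fun_square[OF A] by (rule poly_fun_mono) auto
  then have 2: "card ?R2 \<le> ?b"
    by (rule part[OF _ _ poly_fun_const, where b = "passes s 0"]) simp_all
  have 3: "card ?R3 \<le> ?b"
    by (rule part[OF poly_fun_const _ poly_fun_diff[OF poly_fun_const A], where b = "passes s (- 1)"])
      (cases s; simp)+
  have "reached F U \<subseteq> ?R1 \<union> (?R2 \<union> ?R3)"
  proof
    fix g assume "g \<in> reached F U"
    then obtain y where y: "g \<in> I" "y \<in> U" "F y = 0" "\<forall>i<v. y i = g i"
      by (auto simp: reached_def)
    consider "operand_at r a y > 0" | "operand_at r a y = 0" | "0 - operand_at r a y > 0"
      by linarith
    then show "g \<in> ?R1 \<union> (?R2 \<union> ?R3)"
    proof cases
      case 1
      with y have "g \<in> ?R1"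
        unfolding reached_def by (intro CollectI conjI bexI[of _ y]) auto
      then show ?thesis ..
    next
      case 2
      with y have "g \<in> ?R2"
        unfolding reached_def by (intro CollectI conjI bexI[of _ y]) auto
      then show ?thesis by blast
    next
      case 3
      with y have "g \<in> ?R3"
        unfolding reached_def by (intro CollectI conjI bexI[of _ y]) auto
      then show ?thesis by blast
    qed
  qed
  then have "card (reached F U) \<le> card (?R1 \<union> (?R2 \<union> ?R3))"
    by (intro card_mono) (simp_all add: finite_reached)
  also have "\<dots> \<le> card ?R1 + (card ?R2 + card ?R3)"
    using card_Un_le[of ?R1 "?R2 \<union> ?R3"] card_Un_le[of ?R2 ?R3] by linarith
  finally have "card (reached F U) \<le> 3 * ?b"
    using 1 2 3 by linarith
  then show ?case
    by (simp flip: c_def)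
qed

lemma card_isolated_le:
  assumes "wf_ctree (length inputs) 0 T"
    and "\<And>y. run T (input_vals y) [] = Some (answer y)"
  shows "card I \<le> 3 ^ complexity T * 4 ^ (v + complexity T)"
proof -
  \<comment> \<open>At the root there is no condition yet, so all of \<open>I\<close> is
    reached.\<close>
  have "describes 0 (\<lambda>_. 0) UNIV T"
    using assms by (intro describesI) (simp_all add: results_def poly_fun_const)
  then have "card (reached (\<lambda>_. 0) UNIV) \<le> 3 ^ complexity T * 4 ^ (v + 0 + complexity T)"
    by (rule card_reached_le)
  moreover have "reached (\<lambda>_. 0) UNIV = I"
    by (auto simp: reached_def)
  ultimately show ?thesis
    by simp
qed

end

subsection \<open>Hard instances\<close>

text \<open>The points of color \<open>4\<close> lie on the diagonal. One of them forms a cross with the two extreme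
  points (colors \<open>2\<close> and \<open>3\<close>) and the point \<open>(i + 1, i)\<close> of color \<open>1\<close> iff it lies strictly between
  \<open>(i, i)\<close> and \<open>(i + 1, i + 1)\<close>. So the grid points are isolated in the set of NO instances.\<close>

definition hard_instance :: "nat \<Rightarrow> nat \<Rightarrow> (nat \<Rightarrow> real) \<Rightarrow> colored_point list" where
  "hard_instance m v y =
     [((real m + 1, real m + 1), 2), ((-1, -1), 3)] @
     map (\<lambda>i. ((real i + 1, real i), 1)) [0..<m] @ map (\<lambda>j. ((y j, y j), 4)) [0..<v]"

definition hard_inputs :: "nat \<Rightarrow> nat \<Rightarrow> ((nat \<Rightarrow> real) \<Rightarrow> real) list" where
  "hard_inputs m v =
     [\<lambda>_. real m + 1, \<lambda>_. real m + 1, \<lambda>_. 2, \<lambda>_. -1, \<lambda>_. -1, \<lambda>_. 3] @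
     concat (map (\<lambda>i. [\<lambda>_. real i + 1, \<lambda>_. real i, \<lambda>_. 1]) [0..<m]) @
     concat (map (\<lambda>j. [\<lambda>y. y j, \<lambda>y. y j, \<lambda>_. 4]) [0..<v])"

lemma encode_hard_instance: "encode (hard_instance m v y) = map (\<lambda>f. f y) (hard_inputs m v)"
  by (simp add: encode_def hard_instance_def hard_inputs_def map_concat comp_def)

lemma length_hard_inputs: "length (hard_inputs m v) = 3 * (2 + m + v)"
  by (simp add: hard_inputs_def length_concat comp_def sum_list_triv)

lemma poly_fun_hard_inputs: "f \<in> set (hard_inputs m v) \<Longrightarrow> poly_fun v 1 f"
  using poly_fun_var[of _ v 0] by (auto simp: hard_inputs_def poly_fun_const)

lemma colored_instance_hard_instance: "colored_instance (2 + m + v) 4 (hard_instance m v y)"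
  by (auto simp: colored_instance_def hard_instance_def)

lemma hard_instance_cases:
  assumes "p \<in> set (hard_instance m v y)"
  obtains "p = ((real m + 1, real m + 1), 2)" | "p = ((-1, -1), 3)"
    | i where "i < m" "p = ((real i + 1, real i), 1)"
    | j where "j < v" "p = ((y j, y j), 4)"
  using assms by (auto simp: hard_instance_def)

text \<open>By the bounds on \<open>y\<close> the points of colors \<open>2\<close> and
  \<open>3\<close> are extreme in both coordinates, so they can only serve as NE and SW. Colors
  \<open>1\<close> and \<open>4\<close> share NW and SE; as \<open>(i + 1, i)\<close> lies below the
  diagonal, the diagonal point must be NW, which amounts to the two inequalities.\<close>

lemma cross_hard_instance_iff:
  assumes y: "\<And>j. j < v \<Longrightarrow> -1 \<le> y j \<and> y j \<le> real m + 1"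
  shows "has_four_colored_cross (hard_instance m v y) \<longleftrightarrow>
    (\<exists>j<v. \<exists>i<m. real i < y j \<and> y j < real i + 1)"
proof
  assume "has_four_colored_cross (hard_instance m v y)"
  then obtain c p1 p2 p3 p4 where
    mem: "p1 \<in> set (hard_instance m v y)" "p2 \<in> set (hard_instance m v y)"
      "p3 \<in> set (hard_instance m v y)" "p4 \<in> set (hard_instance m v y)"
    and quad: "fst p1 \<in> quadrant_NE c" "fst p2 \<in> quadrant_NW c"
      "fst p3 \<in> quadrant_SW c" "fst p4 \<in> quadrant_SE c"
    and dist: "distinct [snd p1, snd p2, snd p3, snd p4]"
    unfolding has_four_colored_cross_def by blast
  obtain x1 y1 k1 x2 y2 k2 x3 y3 k3 x4 y4 k4 where
    p: "p1 = ((x1, y1), k1)" "p2 = ((x2, y2), k2)" "p3 = ((x3, y3), k3)" "p4 = ((x4, y4), k4)"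
    by (metis surj_pair)
  obtain a b where c: "c = (a, b)"
    by fastforce
  have q: "a < x1" "b < y1" "x2 < a" "b < y2" "x3 < a" "y3 < b" "a < x4" "y4 < b"
    using quad by (auto simp: p c quadrant_NE_def quadrant_NW_def quadrant_SW_def quadrant_SE_def)
  have bounds: "-1 \<le> s \<and> s \<le> real m + 1 \<and> -1 \<le> t \<and> t \<le> real m + 1 \<and> k \<in> {1, 2, 3, 4} \<and>
      (k = 2 \<longrightarrow> s = real m + 1 \<and> t = real m + 1) \<and> (k = 3 \<longrightarrow> s = -1 \<and> t = -1)"
    if "((s, t), k) \<in> set (hard_instance m v y)" for s t k
    using that y by (cases rule: hard_instance_cases) auto
  note b = mem[unfolded p, THEN bounds]
  have "k2 \<noteq> 2" "k3 \<noteq> 2" "k4 \<noteq> 2" "k1 \<noteq> 3" "k2 \<noteq> 3" "k4 \<noteq> 3"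
    using b q by force+
  then have "k2 = 4 \<and> k4 = 1 \<or> k2 = 1 \<and> k4 = 4"
    using b dist by (auto simp: p)
  then show "\<exists>j<v. \<exists>i<m. real i < y j \<and> y j < real i + 1"
  proof
    assume k: "k2 = 4 \<and> k4 = 1"
    obtain j where "j < v" "x2 = y j" "y2 = y j"
      using mem(2) k unfolding p by (cases rule: hard_instance_cases) auto
    moreover obtain i where "i < m" "x4 = real i + 1" "y4 = real i"
      using mem(4) k unfolding p by (cases rule: hard_instance_cases) auto
    ultimately show ?thesis
      using q by (intro exI[of _ j] exI[of _ i]) auto
  next
    assume k: "k2 = 1 \<and> k4 = 4"
    obtain j where "x4 = y j" "y4 = y j"
      using mem(4) k unfolding p by (cases rule: hard_instance_cases) auto
    moreover obtain i where "x2 = real i + 1" "y2 = real i"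
      using mem(2) k unfolding p by (cases rule: hard_instance_cases) auto
    ultimately show ?thesis
      using q by linarith
  qed
next
  assume "\<exists>j<v. \<exists>i<m. real i < y j \<and> y j < real i + 1"
  then obtain i j where ij: "i < m" "j < v" "real i < y j" "y j < real i + 1"
    by blast
  \<comment> \<open>The centre is the midpoint of \<open>(y j, y j)\<close> and
    \<open>(i + 1, i)\<close>.\<close>
  let ?c = "((y j + real i + 1) / 2, (y j + real i) / 2)"
  have mem: "((real m + 1, real m + 1), 2) \<in> set (hard_instance m v y)"
    "((y j, y j), 4) \<in> set (hard_instance m v y)"
    "((-1, -1), 3) \<in> set (hard_instance m v y)"
    "((real i + 1, real i), 1) \<in> set (hard_instance m v y)"
    using ij by (auto simp: hard_instance_def)
  show "has_four_colored_cross (hard_instance m v y)"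
    unfolding has_four_colored_cross_def
    by (rule exI[of _ ?c], rule bexI[OF _ mem(1)], rule bexI[OF _ mem(2)],
        rule bexI[OF _ mem(3)], rule bexI[OF _ mem(4)])
      (use ij in \<open>auto simp: quadrant_NE_def quadrant_NW_def quadrant_SW_def quadrant_SE_def\<close>)
qed

text \<open>Integers avoid all the open unit intervals, and a number at distance less than
  \<open>1\<close> from \<open>k\<close> that avoids the intervals on both sides of \<open>k\<close>
  equals \<open>k\<close>. Both intervals are present only for \<open>1 \<le> k\<close> and
  \<open>k < m\<close>, hence the range of the grid.\<close>

lemma isolated_instances_hard_instance:
  "isolated_instances v (hard_inputs m v) (\<lambda>y. has_four_colored_cross (hard_instance m v y))
     ({..<v} \<rightarrow>\<^sub>E real ` {1..<m})"
proof
  let ?A = "\<lambda>y. has_four_colored_cross (hard_instance m v y)"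
  show "poly_fun v 1 f" if "f \<in> set (hard_inputs m v)" for f
    using that by (rule poly_fun_hard_inputs)
  show "?A y = ?A y'" if "\<And>i. i < v \<Longrightarrow> y i = y' i" for y y'
  proof -
    have "hard_instance m v y = hard_instance m v y'"
      using that by (simp add: hard_instance_def)
    then show ?thesis
      by simp
  qed
  show "finite ({..<v} \<rightarrow>\<^sub>E real ` {1..<m})"
    by (auto intro: finite_PiE)
  show "g = g'" if "g \<in> {..<v} \<rightarrow>\<^sub>E real ` {1..<m}" "g' \<in> {..<v} \<rightarrow>\<^sub>E real ` {1..<m}"
      "\<And>i. i < v \<Longrightarrow> g i = g' i" for g g'
    using that by (intro PiE_ext) auto
  show "\<exists>\<rho>>0. \<forall>y. (\<forall>i<v. \<bar>y i - g i\<bar> < \<rho>) \<longrightarrow> ?A y = ?A g \<longrightarrow> (\<forall>i<v. y i = g i)"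
    if g: "g \<in> {..<v} \<rightarrow>\<^sub>E real ` {1..<m}" for g
  proof (intro exI[of _ 1] conjI allI impI)
    fix y i
    assume near: "\<forall>i<v. \<bar>y i - g i\<bar> < 1" and eq: "?A y = ?A g" and "i < v"
    have grid: "\<exists>k\<in>{1..<m}. g j = real k" if "j < v" for j
      using g that by blast
    have g_range: "1 \<le> g j \<and> g j \<le> real m" if "j < v" for j
      using grid[OF that] by auto
    have "\<not> ?A g"
    proof -
      have "\<not> (\<exists>j<v. \<exists>i<m. real i < g j \<and> g j < real i + 1)"
        using grid by fastforce
      then show ?thesis
        by (subst cross_hard_instance_iff) (use g_range in fastforce)+
    qed
    moreover have "?A y \<longleftrightarrow> (\<exists>j<v. \<exists>i<m. real i < y j \<and> y j < real i + 1)"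
      by (rule cross_hard_instance_iff) (use g_range near in fastforce)
    ultimately have no: "\<not> (real k < y i \<and> y i < real k + 1)" if "k < m" for k
      using eq \<open>i < v\<close> that by blast
    obtain k where k: "k \<in> {1..<m}" "g i = real k"
      using grid \<open>i < v\<close> by blast
    then have "real (k - 1) = real k - 1"
      by auto
    moreover have "\<bar>y i - real k\<bar> < 1"
      using near \<open>i < v\<close> k by auto
    ultimately show "y i = g i"
      using no[of k] no[of "k - 1"] k by auto
  qed simp
qed

section \<open>The lower bound on the height of the tree\<close>

lemma complexity_bound:
  assumes "solves_four_colored_cross (2 + m + v) T"
  shows "(m - 1) ^ v \<le> 3 ^ complexity T * 4 ^ (v + complexity T)"
proof -
  interpret isolated_instances v "hard_inputs m v"
    "\<lambda>y. has_four_colored_cross (hard_instance m v y)" "{..<v} \<rightarrow>\<^sub>E real ` {1..<m}"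
    by (rule isolated_instances_hard_instance)
  have "card ({..<v} \<rightarrow>\<^sub>E real ` {1..<m}) \<le> 3 ^ complexity T * 4 ^ (v + complexity T)"
  proof (rule card_isolated_le)
    show "wf_ctree (length (hard_inputs m v)) 0 T"
      using assms by (simp only: solves_four_colored_cross_def length_hard_inputs)
    show "run T (input_vals y) [] = Some (has_four_colored_cross (hard_instance m v y))" for y
      using assms colored_instance_hard_instance[of m v y]
      unfolding solves_four_colored_cross_def input_vals_def encode_hard_instance[symmetric]
      by blast
  qed
  moreover have "card (real ` {1..<m}) = m - 1"
    by (subst card_image) auto
  ultimately show ?thesis
    by (simp add: card_PiE)
qed

theorem theorem12:
  shows "\<exists>c::real>0. \<forall>\<^sub>F n in sequentially. \<forall>T. solves_four_colored_cross n T \<longrightarrow>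
     real (complexity T) \<ge> c * (real n * ln (real n))"
proof (intro exI[of _ "1 / (8 * ln 12)"] conjI)
  \<comment> \<open>\<open>12 = 3 * 4\<close> is the cost of one level of the tree. The
    \<open>8\<close> is the product of \<open>4\<close> from \<open>n / 4 \<le> v\<close> and
    \<open>2\<close> from halving the logarithm.\<close>
  show "(0::real) < 1 / (8 * ln 12)"
    by simp
  show "\<forall>\<^sub>F n in sequentially. \<forall>T. solves_four_colored_cross n T \<longrightarrow>
     real (complexity T) \<ge> 1 / (8 * ln 12) * (real n * ln (real n))"
    using eventually_ge_at_top[of 256]
  proof (eventually_elim, intro allI impI)
    fix n :: nat and T
    assume n: "256 \<le> n" and T: "solves_four_colored_cross n T"
    \<comment> \<open>Besides the two extreme points, about half of the points are fixed and half
      move, so base and exponent of \<open>(m - 1) ^ v\<close> are both at least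
      \<open>n / 4\<close>.\<close>
    define m v h where "m = n div 2" and "v = n - 2 - m" and "h = complexity T"
    have mv: "2 + m + v = n" "m > 1" "n \<le> 4 * (m - 1)" "n \<le> 4 * v"
      using n by (auto simp: m_def v_def)
    have "(m - 1) ^ v \<le> 3 ^ h * 4 ^ (v + h)"
      using complexity_bound[of m v T] T unfolding mv(1) h_def by blast
    then have "real ((m - 1) ^ v) \<le> real (3 ^ h * 4 ^ (v + h))"
      by (simp only: of_nat_le_iff)
    moreover have "(12::real) ^ h = 3 ^ h * 4 ^ h"
      by (simp flip: power_mult_distrib)
    ultimately have "real (m - 1) ^ v \<le> 4 ^ v * 12 ^ h"
      by (simp add: power_add mult_ac)
    then have "ln (real (m - 1) ^ v) \<le> ln (4 ^ v * 12 ^ h)"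
      using mv(2) by (subst ln_le_cancel_iff) auto
    then have upper: "real v * (ln (real (m - 1)) - ln 4) \<le> real h * ln 12"
      using mv(2) by (simp add: ln_mult ln_realpow algebra_simps)
    \<comment> \<open>The threshold \<open>256 = 16 ^ 2\<close> is chosen so that half the logarithm
      absorbs \<open>ln 16\<close>: one \<open>ln 4\<close> comes from \<open>n / 4\<close>, the
      other from the factor \<open>4 ^ v\<close>.\<close>
    have "ln (real n) / 2 \<le> ln (real n) - ln 16"
    proof -
      have "ln (256::real) = 2 * ln 16"
        using ln_realpow[of 16 2] by simp
      moreover have "ln (256::real) \<le> ln (real n)"
        using n by simp
      ultimately show ?thesis
        by simp
    qed
    also have "\<dots> = ln (real n / 4) - ln 4"
      using n ln_mult[of 4 4] by (simp add: ln_div)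
    also have "\<dots> \<le> ln (real (m - 1)) - ln 4"
    proof -
      have "real n \<le> 4 * real (m - 1)"
        using mv(3) by linarith
      then show ?thesis
        using n mv(2) by simp
    qed
    finally have "ln (real n) / 2 \<le> ln (real (m - 1)) - ln 4" .
    moreover have "real n / 4 \<le> real v"
      using mv(4) by linarith
    ultimately have "real n / 4 * (ln (real n) / 2) \<le> real v * (ln (real (m - 1)) - ln 4)"
      using n by (intro mult_mono) auto
    with upper have "real n * ln (real n) / 8 \<le> real h * ln 12"
      by simp
    then show "1 / (8 * ln 12) * (real n * ln (real n)) \<le> real (complexity T)"
      by (simp add: h_def field_simps)
  qed
qed

end
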